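(* For any $n,k\in\mathbb{N}$, $$\rho_k^n\le 1+2\pi\qquad\text{and}\qquad \rho_k^n\le 1+\frac{2\pi}{n}+c_k.$$
   Context: Let $\mathcal{C}$ be the unit circle in the Euclidean plane centered at the origin. For $n,k\in\mathbb{N}$, $k$ treasures are hidden at unknown points $\mathbf{T}=(T_1,\dots,T_k)\in\mathcal{C}^k$, and $n$ robots start at time $0$ at the origin. Each robot moves independently anywhere in the plane (not restricted to $\mathcal{C}$) with speed at most $1$. A treasure is discovered when the position of some robot coincides with it; upon discovery all robots instantly learn its location. A strategy specifies the motion of all $n$ robots, where at each time the motion may depend only on the information about treasures discovered so far; $\mathcal{S}_k^n$ is the set of all valid strategies for $n$ robots and $k$ treasures. For $S\in\mathcal{S}_k^n$ let $\rho_S(\mathbf{T})$ be the time required until every robot has individually visited (been at the location of) every treasure. Define $$\rho_k^n=\inf_{S\in\mathcal{S}_k^n}\ \sup_{\mathbf{T}\in\mathcal{C}^k}\rho_S(\mathbf{T}).$$ Separately, let $R=(1,0)$ and let $d(\cdot,\cdot)$ denote Euclidean distance. For $k\in\mathbb{N}$ define $$c_k=\sup_{(T_1,\dots,T_k)\in\mathcal{C}^k}\ \min_\sigma\Big(d(R,T_{\sigma(1)})+\sum_{i=2}^k d(T_{\sigma(i-1)},T_{\sigma(i)})\Big),$$ the minimum being over all permutations $\sigma$ of $\{1,\dots,k\}$. *)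

theory Defs
  imports "HOL-Analysis.Analysis" "HOL-Combinatorics.Permutations" "HOL-Library.Multiset"
begin

text \<open>The plane is \<^typ>\<open>complex\<close>; treasures are indexed by \<open>1..k\<close> and robots by \<open>1..n\<close>.\<close>

definition placements :: "nat \<Rightarrow> (nat \<Rightarrow> complex) set" where
  "placements k = {1..k} \<rightarrow>\<^sub>E sphere 0 1"

text \<open>
  Treasures are indistinguishable, so the information available at time \<open>t\<close> is a multiset of
  locations; treasures at the same point are discovered together and counted with multiplicity.
  Here \<open>X j s\<close> is the position of robot \<open>j\<close> at time \<open>s\<close>.
\<close>

definition discovered ::
    "nat \<Rightarrow> nat \<Rightarrow> (nat \<Rightarrow> real \<Rightarrow> complex) \<Rightarrow> (nat \<Rightarrow> complex) \<Rightarrow> real \<Rightarrow> complex multiset" where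
  "discovered n k X T t =
     image_mset T (mset_set {i \<in> {1..k}. \<exists>j\<in>{1..n}. \<exists>s\<in>{0..t}. X j s = T i})"

text \<open>
  A strategy assigns to every placement the trajectories it produces. The last clause is
  causality: two placements whose discovery histories agree up to time \<open>t\<close> yield
  the same positions at time \<open>t\<close>. Applied at every earlier time as well, it makes the whole
  motion up to \<open>t\<close> a function of the discovery history up to \<open>t\<close>.
\<close>

definition strategies ::
    "nat \<Rightarrow> nat \<Rightarrow> ((nat \<Rightarrow> complex) \<Rightarrow> nat \<Rightarrow> real \<Rightarrow> complex) set" where
  "strategies n k = {S.
     (\<forall>T\<in>placements k. \<forall>j\<in>{1..n}. S T j 0 = 0 \<and> 1-lipschitz_on {0..} (S T j)) \<and>
     (\<forall>T\<in>placements k. \<forall>T'\<in>placements k. \<forall>t\<ge>0.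
        (\<forall>s\<in>{0..t}. discovered n k (S T) T s = discovered n k (S T') T' s) \<longrightarrow>
        (\<forall>j\<in>{1..n}. S T j t = S T' j t))}"

text \<open>The value is \<open>\<infinity>\<close> if some robot never visits some treasure.\<close>

definition completion_time ::
    "nat \<Rightarrow> nat \<Rightarrow> ((nat \<Rightarrow> complex) \<Rightarrow> nat \<Rightarrow> real \<Rightarrow> complex) \<Rightarrow> (nat \<Rightarrow> complex) \<Rightarrow> ereal" where
  "completion_time n k S T =
     Inf {ereal t | t. t \<ge> 0 \<and> (\<forall>j\<in>{1..n}. \<forall>i\<in>{1..k}. \<exists>s\<in>{0..t}. S T j s = T i)}"

definition rho :: "nat \<Rightarrow> nat \<Rightarrow> ereal" where
  "rho n k = (INF S\<in>strategies n k. SUP T\<in>placements k. completion_time n k S T)"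

definition tour_length :: "nat \<Rightarrow> (nat \<Rightarrow> complex) \<Rightarrow> (nat \<Rightarrow> nat) \<Rightarrow> real" where
  "tour_length k T \<sigma> =
     dist (Complex 1 0) (T (\<sigma> 1)) + (\<Sum>i=2..k. dist (T (\<sigma> (i - 1))) (T (\<sigma> i)))"

definition tour_const :: "nat \<Rightarrow> real" where
  "tour_const k = (SUP T\<in>placements k. Min (tour_length k T ` {\<sigma>. \<sigma> permutes {1..k}}))"

end

theory Submission
  imports Defs
begin

text \<open>
  For the first bound every robot ignores all information, walks to \<open>R\<close> and goes once around the
  circle. For the second, robot \<open>j\<close> sweeps the \<open>j\<close>-th of \<open>n\<close> equal arcs; at time \<open>1 + 2\<pi>/n\<close>
  the multiset of all treasures is known, and each robot follows a shortest polyline through it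
  from its current position, which by rotational symmetry has length at most \<open>c\<^sub>k\<close>.
\<close>

section \<open>Trajectories of unit speed\<close>

text \<open>The second motion runs on its own clock, restarted at 0. At the switching time
  \<open>a\<close> the first one still applies, so continuity has to come from
  \<open>f a = g 0\<close>.\<close>

definition join :: "real \<Rightarrow> (real \<Rightarrow> 'a) \<Rightarrow> (real \<Rightarrow> 'a) \<Rightarrow> real \<Rightarrow> 'a" where
  "join a f g t = (if t \<le> a then f t else g (t - a))"

lemma lipschitz_on_shift:
  fixes f :: "real \<Rightarrow> 'a::metric_space"
  assumes "L-lipschitz_on ((\<lambda>t. t + b) ` A) f"
  shows "L-lipschitz_on A (\<lambda>t. f (t + b))"
proof (rule lipschitz_onI)
  show "0 \<le> L" using assms by (rule lipschitz_on_nonneg)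
  show "dist (f (x + b)) (f (y + b)) \<le> L * dist x y" if "x \<in> A" "y \<in> A" for x y
    using lipschitz_onD[OF assms, of "x + b" "y + b"] that by simp
qed

lemma lipschitz_on_join:
  fixes f g :: "real \<Rightarrow> 'a::metric_space"
  assumes f: "L-lipschitz_on {0..a} f" and g: "L-lipschitz_on {0..} g"
    and eq: "f a = g 0"
  shows "L-lipschitz_on {0..} (join a f g)"
proof (rule lipschitz_onI)
  show "0 \<le> L" using f by (rule lipschitz_on_nonneg)
  fix x y :: real
  assume xy: "x \<in> {0..}" "y \<in> {0..}"
  \<comment> \<open>A Lipschitz estimate concerns two points only, so the half-line may be cut at a
    time \<open>c\<close> no earlier than \<open>a\<close>, \<open>x\<close> and
    \<open>y\<close>.\<close>
  define c where "c = max a (max x y)"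
  have "L-lipschitz_on {a..c} (\<lambda>t. g (t - a))"
    using lipschitz_on_shift[of L "- a" "{a..c}" g] lipschitz_on_subset[OF g] by auto
  then have "L-lipschitz_on {0..c} (\<lambda>t. if t \<le> a then f t else g (t - a))"
    using f eq by (intro lipschitz_on_concat) auto
  then have "L-lipschitz_on {0..c} (join a f g)"
    by (simp add: join_def[abs_def])
  then show "dist (join a f g x) (join a f g y) \<le> L * dist x y"
    using xy by (auto intro!: lipschitz_onD simp: c_def)
qed

text \<open>The direction \<open>sgn (q - p)\<close> has norm 1 or is 0, so a leg takes time equal
  to its length. A repeated point gives a leg of duration 0, which covers coinciding
  treasures.\<close>

fun polyline :: "'a::real_normed_vector \<Rightarrow> 'a list \<Rightarrow> real \<Rightarrow> 'a" where
  "polyline p [] = (\<lambda>t. p)"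
| "polyline p (q # qs) = join (dist p q) (\<lambda>t. p + t *\<^sub>R sgn (q - p)) (polyline q qs)"

fun polyline_length :: "'a::metric_space \<Rightarrow> 'a list \<Rightarrow> real" where
  "polyline_length p [] = 0"
| "polyline_length p (q # qs) = dist p q + polyline_length q qs"

lemma polyline_length_nonneg: "0 \<le> polyline_length p qs"
  by (induction p qs rule: polyline_length.induct) auto

lemma polyline_length_snoc:
  "polyline_length p (qs @ [q]) = polyline_length p qs + dist (last (p # qs)) q"
  by (induction p qs rule: polyline_length.induct) auto

lemma segment_end: "p + dist p q *\<^sub>R sgn (q - p) = (q :: 'a::real_normed_vector)"
  by (cases "p = q") (auto simp: sgn_div_norm dist_norm norm_minus_commute)

lemma polyline_0: "polyline p qs 0 = p"
proof (cases qs)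
  case (Cons q rs)
  then show ?thesis by (auto simp: join_def)
qed simp

lemma lipschitz_on_segment:
  "1-lipschitz_on A (\<lambda>t. p + t *\<^sub>R sgn (v :: 'a::real_normed_vector))"
proof (rule lipschitz_onI)
  fix x y :: real
  have "dist (p + x *\<^sub>R sgn v) (p + y *\<^sub>R sgn v) = \<bar>x - y\<bar> * norm (sgn v)"
    by (simp add: dist_norm flip: scaleR_left_diff_distrib)
  also have "\<dots> \<le> 1 * dist x y"
    by (auto simp: norm_sgn dist_real_def)
  finally show "dist (p + x *\<^sub>R sgn v) (p + y *\<^sub>R sgn v) \<le> 1 * dist x y" .
qed simp

lemma lipschitz_on_polyline: "1-lipschitz_on {0..} (polyline p qs)"
proof (induction p qs rule: polyline.induct)
  case (1 p)
  then show ?case by (auto simp: lipschitz_on_def)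
next
  case (2 p q qs)
  then show ?case
    unfolding polyline.simps
    by (intro lipschitz_on_join lipschitz_on_segment) (auto simp: segment_end polyline_0)
qed

lemma polyline_visits:
  assumes "z \<in> set qs"
  shows "\<exists>s\<in>{0..polyline_length p qs}. polyline p qs s = z"
  using assms
proof (induction p qs rule: polyline.induct)
  case (2 p q qs)
  show ?case
  proof (cases "z = q")
    case True
    then have "polyline p (q # qs) (dist p q) = z"
      using segment_end[of p q] by (simp add: join_def)
    then show ?thesis
      using polyline_length_nonneg[of q qs] by (intro bexI[of _ "dist p q"]) auto
  next
    case False
    with 2 obtain s where s: "s \<in> {0..polyline_length q qs}" "polyline q qs s = z"
      by auto
    have "polyline p (q # qs) (dist p q + s) = z"
    \<comment> \<open>At \<open>s = 0\<close> the first leg is still in force; but then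
      \<open>z\<close> would be the starting point \<open>q\<close> of the remaining polyline, which
      is excluded here.\<close>
    proof (cases "s = 0")
      case True
      with s False show ?thesis by (simp add: polyline_0)
    next
      case False
      with s show ?thesis by (auto simp: join_def)
    qed
    with s show ?thesis by (intro bexI[of _ "dist p q + s"]) auto
  qed
qed simp

text \<open>The circular phase never stops, so the same motion serves for the full turn and for each
  of the \<open>n\<close> arcs; the cut is made in time.\<close>

definition sweep :: "real \<Rightarrow> real \<Rightarrow> complex" where
  "sweep \<theta> = join 1 (\<lambda>t. t *\<^sub>R cis \<theta>) (\<lambda>t. cis (\<theta> + t))"

text \<open>A chord is no longer than its arc: after rotation, the chord over angle \<open>u\<close>
  has length \<open>2 * \<bar>sin (u / 2)\<bar>\<close>.\<close>

lemma lipschitz_on_cis: "1-lipschitz_on A cis"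
proof (rule lipschitz_onI)
  fix x y :: real
  have "cis x - cis y = cis y * (cis (x - y) - 1)"
    by (simp add: right_diff_distrib cis_mult)
  then have "dist (cis x) (cis y) = norm (cis (x - y) - 1)"
    by (simp add: dist_norm norm_mult)
  also have "\<dots> = 2 * \<bar>sin ((x - y) / 2)\<bar>"
    using dist_exp_i_1[of "x - y"] by (simp add: cis_conv_exp)
  also have "\<dots> \<le> 1 * dist x y"
    using abs_sin_x_le_abs_x[of "(x - y) / 2"] by (simp add: dist_real_def)
  finally show "dist (cis x) (cis y) \<le> 1 * dist x y" .
qed simp

lemma lipschitz_on_sweep: "1-lipschitz_on {0..} (sweep \<theta>)"
  unfolding sweep_def
proof (rule lipschitz_on_join)
  show "1-lipschitz_on {0..1} (\<lambda>t. t *\<^sub>R cis \<theta>)"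
    using lipschitz_on_segment[of "{0..1}" 0 "cis \<theta>"] by (simp add: sgn_div_norm)
  show "1-lipschitz_on {0..} (\<lambda>t. cis (\<theta> + t))"
    using lipschitz_on_shift[OF lipschitz_on_cis, of "{0..}" \<theta>] by (simp add: add.commute)
qed simp

lemma sweep_0: "sweep \<theta> 0 = 0"
  by (simp add: sweep_def join_def)

lemma sweep_arc:
  assumes "1 \<le> t"
  shows "sweep \<theta> t = cis (\<theta> + (t - 1))"
  using assms by (auto simp: sweep_def join_def)

lemma unit_eq_cis:
  assumes "z \<in> sphere 0 (1::real)"
  obtains \<phi> where "0 \<le> \<phi>" "\<phi> < 2 * pi" "z = cis \<phi>"
proof (rule that)
  show "0 \<le> Arg2pi z" "Arg2pi z < 2 * pi" using Arg2pi[of z] by auto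
  show "z = cis (Arg2pi z)"
    using Arg2pi_eq[of z] assms by (simp add: cis_conv_exp)
qed

section \<open>Strategies\<close>

lemma completion_time_le:
  assumes "0 \<le> t"
    and "\<And>i j. i \<in> {1..k} \<Longrightarrow> j \<in> {1..n} \<Longrightarrow> \<exists>s\<in>{0..t}. S T j s = T i"
  shows "completion_time n k S T \<le> ereal t"
  unfolding completion_time_def by (rule Inf_lower) (use assms in blast)

lemma rho_le:
  assumes "S \<in> strategies n k"
    and "\<And>T. T \<in> placements k \<Longrightarrow> completion_time n k S T \<le> b"
  shows "rho n k \<le> b"
  unfolding rho_def by (rule INF_lower2[OF assms(1)]) (rule SUP_least, rule assms(2))

lemma placementsD: "T \<in> placements k \<Longrightarrow> i \<in> {1..k} \<Longrightarrow> T i \<in> sphere 0 1"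
  unfolding placements_def by auto

lemma rho_le_circle: "rho n k \<le> ereal (1 + 2 * pi)"
proof (rule rho_le)
  \<comment> \<open>Causality is immediate, as the motion is the same for all placements.\<close>
  show "(\<lambda>T j. sweep 0) \<in> strategies n k"
    using lipschitz_on_sweep by (auto simp: strategies_def sweep_0)
  fix T assume T: "T \<in> placements k"
  show "completion_time n k (\<lambda>T j. sweep 0) T \<le> ereal (1 + 2 * pi)"
  proof (rule completion_time_le)
    fix i j assume "i \<in> {1..k}"
    then obtain \<phi> where "0 \<le> \<phi>" "\<phi> < 2 * pi" "T i = cis \<phi>"
      using placementsD[OF T] unit_eq_cis by blast
    then show "\<exists>s\<in>{0..1 + 2 * pi}. sweep 0 s = T i"
      by (intro bexI[of _ "1 + \<phi>"]) (auto simp: sweep_arc)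
  qed auto
qed

text \<open>Rounding down the angle of \<open>z\<close> in units of \<open>2 * pi / n\<close> gives
  the arc that contains it.\<close>

lemma arcs_cover_circle:
  assumes "n \<ge> 1" and "z \<in> sphere 0 1"
  shows "\<exists>j\<in>{1..n}. \<exists>s\<in>{0..1 + 2 * pi / n}. sweep (2 * pi * (real j - 1) / n) s = z"
proof -
  obtain \<phi> where \<phi>: "0 \<le> \<phi>" "\<phi> < 2 * pi" "z = cis \<phi>"
    using unit_eq_cis assms(2) by blast
  define m where "m = nat \<lfloor>\<phi> * n / (2 * pi)\<rfloor>"
  have n: "real n > 0" using assms by simp
  have "0 \<le> \<phi> * n / (2 * pi)" using \<phi> by simp
  then have m: "real m \<le> \<phi> * n / (2 * pi)" "\<phi> * n / (2 * pi) < real m + 1"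
    unfolding m_def by linarith+
  have "\<phi> * n / (2 * pi) < n" using \<phi> n by (simp add: field_simps)
  then have "m < n" using m by linarith
  moreover have "2 * pi * m / n \<le> \<phi>" "\<phi> \<le> 2 * pi * m / n + 2 * pi / n"
    using m n by (simp_all add: field_simps)
  ultimately show ?thesis
    using \<phi>(3)
    \<comment> \<open>Arcs are counted from 0 and robots from 1. One unit of time leads to the
      circle, the rest is the angle past the start of the arc.\<close>
    by (intro bexI[of _ "Suc m"] bexI[of _ "1 + (\<phi> - 2 * pi * m / n)"]) (auto simp: sweep_arc)
qed

section \<open>Tours\<close>

text \<open>Links the recursive length of a list to the indexed sum in \<open>tour_length\<close>.
  The sum grows at its upper end, hence the induction appends a last point.\<close>

lemma polyline_length_tour:
  assumes "k \<ge> 1"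
  shows "polyline_length p (map f [1..<Suc k]) = dist p (f 1) + (\<Sum>i=2..k. dist (f (i - 1)) (f i))"
  using assms
proof (induction k rule: dec_induct)
  case (step k)
  then have "last (p # map f [1..<Suc k]) = f k" by simp
  moreover have "map f [1..<Suc (Suc k)] = map f [1..<Suc k] @ [f (Suc k)]" by simp
  ultimately show ?case
    using step by (simp only: polyline_length_snoc) (simp add: sum.cl_ivl_Suc)
qed simp

text \<open>Each of the \<open>k\<close> legs is a chord, at most a diameter. This crude bound makes
  the real supremum in \<open>tour_const\<close> meaningful.\<close>

lemma tour_length_le:
  assumes "T \<in> placements k" and "\<sigma> permutes {1..k}" and "k \<ge> 1"
  shows "tour_length k T \<sigma> \<le> 2 * real k"
proof -
  have unit: "norm (T (\<sigma> i)) = 1" if "i \<in> {1..k}" for i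
    using placementsD[OF assms(1)] permutes_in_image[OF assms(2)] that by simp
  have two: "dist x y \<le> 2" if "norm x = 1" "norm y = 1" for x y :: complex
    using norm_triangle_ineq4[of x y] that by (simp add: dist_norm)
  have "dist (Complex 1 0) (T (\<sigma> 1)) \<le> 2"
    using assms(3) by (intro two unit) (auto simp: cmod_def)
  moreover have "(\<Sum>i=2..k. dist (T (\<sigma> (i - 1))) (T (\<sigma> i))) \<le> (\<Sum>i=2..k. 2)"
    by (intro sum_mono two unit) auto
  ultimately show ?thesis
    using assms(3) by (simp add: tour_length_def of_nat_diff)
qed

text \<open>The supremum is over a bounded set, and the minimum over finitely many permutations is
  attained.\<close>

lemma tour_const_upper:
  assumes "T \<in> placements k" and "k \<ge> 1"
  obtains \<sigma> where "\<sigma> permutes {1..k}" and "tour_length k T \<sigma> \<le> tour_const k"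
proof -
  let ?P = "{\<sigma>. \<sigma> permutes {1..k}}"
  have fin: "finite ?P" by (simp add: finite_permutations)
  have id: "id \<in> ?P" by (simp add: permutes_id)
  have "Min (tour_length k T' ` ?P) \<le> 2 * real k" if "T' \<in> placements k" for T'
  proof -
    have "Min (tour_length k T' ` ?P) \<le> tour_length k T' id"
      using fin id by (intro Min_le finite_imageI imageI)
    also have "\<dots> \<le> 2 * real k"
      using that id assms(2) by (intro tour_length_le) auto
    finally show ?thesis .
  qed
  then have "bdd_above ((\<lambda>T. Min (tour_length k T ` ?P)) ` placements k)"
    by (intro bdd_aboveI2)
  then have "Min (tour_length k T ` ?P) \<le> tour_const k"
    unfolding tour_const_def using assms(1) by (rule cSUP_upper2) simp
  moreover have "Min (tour_length k T ` ?P) \<in> tour_length k T ` ?P"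
    using fin id by (intro Min_in finite_imageI) blast+
  ultimately show thesis using that by auto
qed

text \<open>Rotating the plane by \<open>1 / p\<close> moves the starting point \<open>p\<close> to \<open>R\<close>.\<close>

lemma short_polyline_exists:
  assumes T: "T \<in> placements k" and k: "k \<ge> 1" and p: "norm p = 1"
  shows "\<exists>qs. mset qs = image_mset T (mset_set {1..k}) \<and> polyline_length p qs \<le> tour_const k"
proof -
  \<comment> \<open>Placements are extensional functions, hence \<open>restrict\<close>.\<close>
  define T' where "T' = restrict (\<lambda>i. T i / p) {1..k}"
  have "T' \<in> placements k"
    using placementsD[OF T] p by (auto simp: T'_def placements_def norm_divide)
  then obtain \<sigma> where \<sigma>: "\<sigma> permutes {1..k}" "tour_length k T' \<sigma> \<le> tour_const k"
    using k by (rule tour_const_upper)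
  have in_k: "\<sigma> i \<in> {1..k}" if "i \<in> {1..k}" for i
    using permutes_in_image[OF \<sigma>(1)] that by simp
  have p0: "p \<noteq> 0" using p by auto
  have rotate: "dist (x / p) (y / p) = dist x y" for x y
    using p by (simp add: dist_norm norm_divide flip: diff_divide_distrib)
  have T'_\<sigma>: "T' (\<sigma> i) = T (\<sigma> i) / p" if "i \<in> {1..k}" for i
    using in_k[OF that] by (simp add: T'_def)
  \<comment> \<open>The order that is short for the rotated treasures is used for the original
    ones.\<close>
  let ?qs = "map (T \<circ> \<sigma>) [1..<Suc k]"
  have "dist (Complex 1 0) (T' (\<sigma> 1)) = dist p (T (\<sigma> 1))"
    using rotate[of p "T (\<sigma> 1)"] p0 k by (simp add: T'_\<sigma> one_complex.code)
  moreover have "dist (T' (\<sigma> (i - 1))) (T' (\<sigma> i)) = dist (T (\<sigma> (i - 1))) (T (\<sigma> i))"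
    if "i \<in> {2..k}" for i
  proof -
    have "i - 1 \<in> {1..k}" "i \<in> {1..k}" using that by auto
    then show ?thesis by (simp only: T'_\<sigma> rotate)
  qed
  ultimately have "polyline_length p ?qs = tour_length k T' \<sigma>"
    unfolding polyline_length_tour[OF k] tour_length_def by simp
  moreover have "mset ?qs = image_mset T (mset_set {1..k})"
  proof -
    have "mset ?qs = image_mset T (image_mset \<sigma> (mset_set {1..k}))"
      by (simp add: multiset.map_comp atLeastLessThanSuc_atLeastAtMost del: upt_Suc)
    also have "image_mset \<sigma> (mset_set {1..k}) = mset_set {1..k}"
      using \<sigma>(1) by (rule permutes_image_mset)
    finally show ?thesis .
  qed
  ultimately show ?thesis using \<sigma>(2) by metis
qed

text \<open>The choice sees only the position \<open>p\<close> and the multiset \<open>M\<close>, so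
  it cannot use the labels of the treasures; causality rests on this.\<close>

definition short_tour :: "nat \<Rightarrow> complex \<Rightarrow> complex multiset \<Rightarrow> complex list" where
  "short_tour k p M = (SOME qs. mset qs = M \<and> polyline_length p qs \<le> tour_const k)"

lemma short_tour:
  assumes "T \<in> placements k" and "k \<ge> 1" and "norm p = 1"
  defines "qs \<equiv> short_tour k p (image_mset T (mset_set {1..k}))"
  shows "set qs = T ` {1..k}" and "polyline_length p qs \<le> tour_const k"
proof -
  have *: "mset qs = image_mset T (mset_set {1..k}) \<and> polyline_length p qs \<le> tour_const k"
    unfolding qs_def short_tour_def
    by (rule someI_ex) (rule short_polyline_exists[OF assms(1-3)])
  then show "polyline_length p qs \<le> tour_const k" by simp
  have "set_mset (mset qs) = T ` {1..k}" using * by simp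
  then show "set qs = T ` {1..k}" by simp
qed

lemma rho_le_tour:
  assumes n: "n \<ge> 1" and k: "k \<ge> 1"
  shows "rho n k \<le> ereal (1 + 2 * pi / n + tour_const k)"
proof -
  define a where "a = 1 + 2 * pi / n"
  define M where "M T = image_mset T (mset_set {1..k})" for T :: "nat \<Rightarrow> complex"
  define f where "f j = sweep (2 * pi * (real j - 1) / n)" for j :: nat
  define p where "p j = f j a" for j
  \<comment> \<open>The position \<open>p j\<close> at the end of the search is the same for all
    placements; \<open>T\<close> enters only through \<open>M T\<close>, after time
    \<open>a\<close>.\<close>
  define S where "S T j = join a (f j) (polyline (p j) (short_tour k (p j) (M T)))" for T j
  have a: "a \<ge> 1" by (simp add: a_def)
  have p: "norm (p j) = 1" for j using a by (simp add: p_def f_def sweep_arc)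
  have early: "S T j t = f j t" if "t \<le> a" for T j t
    using that by (simp add: S_def join_def)
  have all_found: "discovered n k (S T) T a = M T" if "T \<in> placements k" for T
  proof -
    have "\<exists>j\<in>{1..n}. \<exists>s\<in>{0..a}. S T j s = T i" if "i \<in> {1..k}" for i
      using arcs_cover_circle[OF n placementsD[OF \<open>T \<in> placements k\<close> that]] early
      by (force simp: a_def f_def)
    then have "{i \<in> {1..k}. \<exists>j\<in>{1..n}. \<exists>s\<in>{0..a}. S T j s = T i} = {1..k}"
      by blast
    then show ?thesis by (simp add: discovered_def M_def)
  qed
  show ?thesis
  proof (rule rho_le)
    show "S \<in> strategies n k"
      unfolding strategies_def
    proof (intro CollectI conjI ballI allI impI)
      fix T j
      show "S T j 0 = 0" using a by (simp add: early f_def sweep_0)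
      show "1-lipschitz_on {0..} (S T j)"
        unfolding S_def
      proof (rule lipschitz_on_join)
        show "1-lipschitz_on {0..a} (f j)"
          unfolding f_def by (rule lipschitz_on_subset[OF lipschitz_on_sweep]) auto
      qed (auto simp: lipschitz_on_polyline polyline_0 p_def)
    next
      fix T T' t j
      assume T: "T \<in> placements k" "T' \<in> placements k"
        and agree: "\<forall>s\<in>{0..t}. discovered n k (S T) T s = discovered n k (S T') T' s"
      show "S T j t = S T' j t"
      proof (cases "t \<le> a")
        \<comment> \<open>Now \<open>a\<close> lies in \<open>{0..t}\<close>, so the histories agree
          at \<open>a\<close>, when both consist of all treasures.\<close>
        case False
        then have "M T = M T'"
          using agree a all_found[OF T(1)] all_found[OF T(2)] by auto
        then show ?thesis by (simp add: S_def)
      qed (simp add: early)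
    qed
  next
    fix T assume T: "T \<in> placements k"
    let ?len = "\<lambda>j. polyline_length (p j) (short_tour k (p j) (M T))"
    have len: "?len j \<le> tour_const k" for j
      unfolding M_def by (rule short_tour[OF T k p])
    show "completion_time n k S T \<le> ereal (1 + 2 * pi / n + tour_const k)"
    proof (rule completion_time_le)
      \<comment> \<open>\<open>tour_const k\<close> is nonnegative because it bounds the length of
        an actual polyline.\<close>
      show "0 \<le> 1 + 2 * pi / n + tour_const k"
        using a len[of 1] polyline_length_nonneg[of "p 1" "short_tour k (p 1) (M T)"]
        unfolding a_def by linarith
      fix i j assume "i \<in> {1..k}"
      then have "T i \<in> set (short_tour k (p j) (M T))"
        unfolding M_def short_tour(1)[OF T k p] by blast
      then obtain s where s: "s \<in> {0..?len j}"
        and visit: "polyline (p j) (short_tour k (p j) (M T)) s = T i"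
        using polyline_visits by blast
      have "S T j (a + s) = T i"
      \<comment> \<open>At \<open>s = 0\<close> the sweep is still in force, and its endpoint
        \<open>p j\<close> is where the polyline begins.\<close>
      proof (cases "s = 0")
        case True
        with visit show ?thesis by (simp add: early polyline_0 p_def)
      next
        case False
        with s visit show ?thesis by (auto simp: S_def join_def)
      qed
      then show "\<exists>s\<in>{0..1 + 2 * pi / n + tour_const k}. S T j s = T i"
        using s a len[of j] by (intro bexI[of _ "a + s"]) (auto simp: a_def)
    qed
  qed
qed

theorem lemma14:
  fixes n k :: nat
  assumes "n \<ge> 1" and "k \<ge> 1"
  shows "rho n k \<le> ereal (1 + 2 * pi) \<and> rho n k \<le> ereal (1 + 2 * pi / real n + tour_const k)"
  using rho_le_circle rho_le_tour[OF assms] by blast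

end
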